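(* (1) Let $n\ge1$ and $f:\{0,1\}^n\to\{0,1\}$, $f(x)=\prod_{i=1}^n x_i$. Then for every increasing $g:\{0,1\}^n\to\{0,1\}$, $$\sum_{\varnothing\ne S\subseteq[n]}\hat g(S)^2\max_{i\in S}\mathrm{Inf}_i[f]\;=\;\frac{2\,\mathrm{Cov}(f,g)\,\mathrm{Cov}(f,g^* )}{\mathrm{Cov}(f,g)+\mathrm{Cov}(f,g^* )},$$ where the right-hand side is defined to be zero when the denominator vanishes. (2) The factor $1/4$ in the inequality $\mathrm{Cov}(f,g)\ge\frac14\min_{i\in[n]}\mathrm{Inf}_i[f]$ (for increasing $f,g:\{0,1\}^n\to\{0,1\}$ with $g$ antipodal) is optimal: there is no constant $c>\frac14$ such that $\mathrm{Cov}(f,g)\ge c\min_{i\in[n]}\mathrm{Inf}_i[f]$ holds for all $n\ge1$ and all increasing $f,g:\{0,1\}^n\to\{0,1\}$ with $g$ antipodal.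
   Context: $[n]=\{1,\dots,n\}$. The cube $\{0,1\}^n$ carries the uniform probability measure, $X$ denotes a uniform random point of $\{0,1\}^n$, and $\mathbb{E}$, $\mathbb{P}$ are taken with respect to it. A function $\{0,1\}^n\to\{0,1\}$ is increasing if it is nondecreasing in each coordinate. $\mathrm{Cov}(f,g)=\mathbb{E}[fg]-\mathbb{E}[f]\mathbb{E}[g]$. The influence is $\mathrm{Inf}_i[f]=\mathbb{P}[f(X)\neq f(X\oplus\mathbf{1}_{\{i\}})]$, where $\mathbf{1}_{\{i\}}$ is the indicator vector of $\{i\}$ and $\oplus$ is coordinatewise addition modulo $2$. The dual of $g$ is $g^*(x)=1-g(1-x)$, where $1-x$ is the coordinatewise complement of $x$; $g$ is antipodal if $g=g^*$. The Fourier coefficients are $\hat g(S)=\mathbb{E}[g(X)\chi_S(X)]$ with $\chi_S(x)=(-1)^{\sum_{i\in S}x_i}$ for $S\subseteq[n]$. *)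

theory Defs
  imports "HOL-Probability.Probability"
begin

text \<open>A point of the cube is a function on \<open>{1..n}\<close> with values in \<open>{0, 1}\<close>, extended by
  \<open>undefined\<close> outside \<open>{1..n}\<close>. A function on the cube is a real-valued function whose values
  off the cube are irrelevant: every notion below only looks at values on the cube.\<close>

definition cube :: "nat \<Rightarrow> (nat \<Rightarrow> nat) set" where
  "cube n = {1..n} \<rightarrow>\<^sub>E {0, 1}"

definition boolean_function :: "nat \<Rightarrow> ((nat \<Rightarrow> nat) \<Rightarrow> real) \<Rightarrow> bool" where
  "boolean_function n f \<longleftrightarrow> f \<in> cube n \<rightarrow> {0, 1}"

definition coordinatewise_increasing :: "nat \<Rightarrow> ((nat \<Rightarrow> nat) \<Rightarrow> real) \<Rightarrow> bool" where
  "coordinatewise_increasing n f \<longleftrightarrow> (\<forall>x\<in>cube n. \<forall>i\<in>{1..n}. f (x(i := 0)) \<le> f (x(i := 1)))"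

definition uniform_cube :: "nat \<Rightarrow> (nat \<Rightarrow> nat) pmf" where
  "uniform_cube n = pmf_of_set (cube n)"

definition expect :: "nat \<Rightarrow> ((nat \<Rightarrow> nat) \<Rightarrow> real) \<Rightarrow> real" where
  "expect n f = measure_pmf.expectation (uniform_cube n) f"

definition Cov :: "nat \<Rightarrow> ((nat \<Rightarrow> nat) \<Rightarrow> real) \<Rightarrow> ((nat \<Rightarrow> nat) \<Rightarrow> real) \<Rightarrow> real" where
  "Cov n f g = expect n (\<lambda>x. f x * g x) - expect n f * expect n g"

definition add_mod2 :: "nat \<Rightarrow> (nat \<Rightarrow> nat) \<Rightarrow> (nat \<Rightarrow> nat) \<Rightarrow> (nat \<Rightarrow> nat)" where
  "add_mod2 n x y = (\<lambda>i\<in>{1..n}. (x i + y i) mod 2)"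

definition influence :: "nat \<Rightarrow> nat \<Rightarrow> ((nat \<Rightarrow> nat) \<Rightarrow> real) \<Rightarrow> real" where
  "influence n i f =
     measure_pmf.prob (uniform_cube n) {x. f x \<noteq> f (add_mod2 n x (indicator {i}))}"

definition cube_complement :: "nat \<Rightarrow> (nat \<Rightarrow> nat) \<Rightarrow> (nat \<Rightarrow> nat)" where
  "cube_complement n x = (\<lambda>i\<in>{1..n}. 1 - x i)"

definition dual :: "nat \<Rightarrow> ((nat \<Rightarrow> nat) \<Rightarrow> real) \<Rightarrow> ((nat \<Rightarrow> nat) \<Rightarrow> real)" where
  "dual n g = (\<lambda>x. 1 - g (cube_complement n x))"

definition antipodal :: "nat \<Rightarrow> ((nat \<Rightarrow> nat) \<Rightarrow> real) \<Rightarrow> bool" where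
  "antipodal n g \<longleftrightarrow> (\<forall>x\<in>cube n. g x = dual n g x)"

definition chi :: "nat set \<Rightarrow> (nat \<Rightarrow> nat) \<Rightarrow> real" where
  "chi S x = (- 1) ^ (\<Sum>i\<in>S. x i)"

definition fourier :: "nat \<Rightarrow> ((nat \<Rightarrow> nat) \<Rightarrow> real) \<Rightarrow> nat set \<Rightarrow> real" where
  "fourier n g S = expect n (\<lambda>x. g x * chi S x)"

definition and_function :: "nat \<Rightarrow> (nat \<Rightarrow> nat) \<Rightarrow> real" where
  "and_function n x = (\<Prod>i\<in>{1..n}. real (x i))"

end

theory Submission
  imports Defs
begin

text \<open>Write \<open>f\<close> for the conjunction of all coordinates and \<open>p\<close> for the mean of \<open>g\<close>. Every
  coordinate of \<open>f\<close> has the same influence \<open>2 / 2 ^ n\<close>, so the maximum leaves the Fourier sum as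
  a constant factor, and Parseval's identity turns what remains into the variance of \<open>g\<close>, which is
  \<open>p * (1 - p)\<close> because \<open>g\<close> is Boolean.

  On the other side, \<open>f\<close> is the indicator of the all-ones point. Hence its covariance with \<open>g\<close> is
  \<open>(g(1, ..., 1) - p) / 2 ^ n\<close>, and its covariance with the dual is \<open>(p - g(0, ..., 0)) / 2 ^ n\<close>. An
  increasing Boolean \<open>g\<close> is either constant, and then both sides vanish, or takes the values \<open>0\<close>
  and \<open>1\<close> at the two extreme points. In the latter case the covariances are \<open>(1 - p) / 2 ^ n\<close>
  and \<open>p / 2 ^ n\<close>; their sum is \<open>1 / 2 ^ n\<close>, so twice their product over their sum is the constant
  influence times the variance.

  For the optimality of \<open>1/4\<close>, the conjunction against any antipodal increasing \<open>g\<close> already has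
  covariance exactly a quarter of its influence, as \<open>p = 1/2\<close>. The smallest instance suffices:
  on one coordinate, the identity function against itself.\<close>

section \<open>Averages over the cube\<close>

lemma finite_cube: "finite (cube n)"
  unfolding cube_def by (intro finite_PiE) auto

lemma card_cube: "card (cube n) = 2 ^ n"
  unfolding cube_def by (simp add: card_PiE numeral_2_eq_2)

lemma cube_not_empty: "cube n \<noteq> {}"
  using card_cube[of n] by auto

lemma expect_eq_average: "expect n f = (\<Sum>x\<in>cube n. f x) / 2 ^ n"
  unfolding expect_def uniform_cube_def
  by (simp add: integral_pmf_of_set finite_cube cube_not_empty card_cube)

lemma cube_value: "x \<in> cube n \<Longrightarrow> i \<in> {1..n} \<Longrightarrow> x i = 0 \<or> x i = 1"
  unfolding cube_def by (auto simp: PiE_iff)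

lemma cube_eqI:
  assumes "x \<in> cube n" "y \<in> cube n" "\<And>i. i \<in> {1..n} \<Longrightarrow> x i = y i"
  shows "x = y"
  using assms unfolding cube_def by (rule PiE_ext)

lemma fun_upd_in_cube:
  "x \<in> cube n \<Longrightarrow> i \<in> {1..n} \<Longrightarrow> b \<in> {0, 1} \<Longrightarrow> x(i := b) \<in> cube n"
  unfolding cube_def by (auto simp: PiE_iff extensional_def)

lemma cube_complement_in_cube: "cube_complement n x \<in> cube n"
  unfolding cube_def cube_complement_def by (auto simp: PiE_iff)

lemma cube_complement_involution:
  assumes "x \<in> cube n"
  shows "cube_complement n (cube_complement n x) = x"
proof (rule cube_eqI[OF cube_complement_in_cube assms])
  fix i assume "i \<in> {1..n}"
  with cube_value[OF assms this] show "cube_complement n (cube_complement n x) i = x i"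
    by (auto simp: cube_complement_def)
qed

text \<open>Complementation permutes the cube, hence preserves the uniform measure.\<close>

lemma expect_dual: "expect n (dual n g) = 1 - expect n g"
proof -
  have "(\<Sum>x\<in>cube n. g (cube_complement n x)) = (\<Sum>x\<in>cube n. g x)"
    by (rule sum.reindex_bij_witness[where i = "cube_complement n" and j = "cube_complement n"])
       (auto simp: cube_complement_in_cube cube_complement_involution)
  then show ?thesis
    by (simp add: expect_eq_average dual_def sum_subtractf card_cube diff_divide_distrib)
qed

section \<open>Parseval's identity\<close>

lemma chi_eq_prod: "chi S x = (\<Prod>i\<in>S. (- 1) ^ x i)"
  unfolding chi_def by (rule power_sum)

text \<open>The sum over all characters factors as \<open>\<Prod>i. ((-1) ^ (x i + y i) + 1)\<close>, and a
  coordinate where \<open>x\<close> and \<open>y\<close> differ contributes a zero factor.\<close>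

lemma sum_characters:
  assumes x: "x \<in> cube n" and y: "y \<in> cube n"
  shows "(\<Sum>S\<in>Pow {1..n}. chi S x * chi S y) = (if x = y then 2 ^ n else 0)"
proof -
  have "(\<Sum>S\<in>Pow {1..n}. chi S x * chi S y) = (\<Sum>S\<in>Pow {1..n}. \<Prod>i\<in>S. (- 1) ^ (x i + y i))"
    by (simp add: chi_eq_prod prod.distrib power_add)
  also have "\<dots> = (\<Prod>i\<in>{1..n}. (- 1) ^ (x i + y i) + 1)"
    by (subst prod_add) simp_all
  also have "\<dots> = (if x = y then 2 ^ n else 0)"
  proof (cases "x = y")
    case False
    then obtain i where i: "i \<in> {1..n}" "x i \<noteq> y i"
      using cube_eqI[OF x y] by blast
    then have "(- 1) ^ (x i + y i) + 1 = (0::real)"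
      using cube_value[OF x i(1)] cube_value[OF y i(1)] by auto
    with i(1) False show ?thesis
      by (auto intro!: prod_zero)
  qed (simp add: mult_2[symmetric])
  finally show ?thesis .
qed

lemma parseval: "(\<Sum>S\<in>Pow {1..n}. (fourier n g S)\<^sup>2) = expect n (\<lambda>x. (g x)\<^sup>2)"
proof -
  have "(\<Sum>S\<in>Pow {1..n}. (fourier n g S)\<^sup>2) =
      (\<Sum>S\<in>Pow {1..n}. \<Sum>x\<in>cube n. \<Sum>y\<in>cube n. g x * g y * (chi S x * chi S y)) / (2 ^ n)\<^sup>2"
    by (simp add: fourier_def expect_eq_average power_divide power2_eq_square sum_product
        sum_divide_distrib[symmetric] mult_ac)
  also have "(\<Sum>S\<in>Pow {1..n}. \<Sum>x\<in>cube n. \<Sum>y\<in>cube n. g x * g y * (chi S x * chi S y)) =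
      (\<Sum>x\<in>cube n. \<Sum>y\<in>cube n. g x * g y * (\<Sum>S\<in>Pow {1..n}. chi S x * chi S y))"
    by (subst sum.swap, rule sum.cong[OF refl], subst sum.swap) (simp add: sum_distrib_left)
  also have "\<dots> = (\<Sum>x\<in>cube n. \<Sum>y\<in>cube n. if x = y then 2 ^ n * (g x * g y) else 0)"
    by (intro sum.cong refl) (simp add: sum_characters del: One_nat_def)
  also have "\<dots> = 2 ^ n * (\<Sum>x\<in>cube n. (g x)\<^sup>2)"
    by (simp add: finite_cube sum_distrib_left power2_eq_square)
  finally show ?thesis
    by (simp add: expect_eq_average power2_eq_square)
qed

lemma parseval_variance:
  "(\<Sum>S\<in>{S. S \<noteq> {} \<and> S \<subseteq> {1..n}}. (fourier n g S)\<^sup>2) = expect n (\<lambda>x. (g x)\<^sup>2) - (expect n g)\<^sup>2"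
proof -
  have "{S. S \<noteq> {} \<and> S \<subseteq> {1..n}} = Pow {1..n} - {{}}"
    by auto
  then have "(\<Sum>S\<in>{S. S \<noteq> {} \<and> S \<subseteq> {1..n}}. (fourier n g S)\<^sup>2) =
      (\<Sum>S\<in>Pow {1..n}. (fourier n g S)\<^sup>2) - (fourier n g {})\<^sup>2"
    by (simp add: sum_diff1)
  also have "fourier n g {} = expect n g"
    by (simp add: fourier_def chi_def)
  finally show ?thesis
    by (simp only: parseval)
qed

section \<open>Monotonicity\<close>

text \<open>Passing from \<open>x\<close> to \<open>y\<close> one coordinate at a time, no step decreases \<open>g\<close>.\<close>

lemma coordinatewise_increasing_mono:
  assumes g: "coordinatewise_increasing n g" and x: "x \<in> cube n" and y: "y \<in> cube n"
    and le: "\<And>i. i \<in> {1..n} \<Longrightarrow> x i \<le> y i"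
  shows "g x \<le> g y"
proof -
  (* the point on the way whose coordinates in A have already been changed *)
  define z where "z A = (\<lambda>i. if i \<in> A then y i else x i)" for A
  have "z A \<in> cube n \<and> g x \<le> g (z A)" if "finite A" "A \<subseteq> {1..n}" for A
    using that
  proof (induction A)
    case empty
    then show ?case using x by (simp add: z_def)
  next
    case (insert i A)
    then have i: "i \<in> {1..n}" and IH: "z A \<in> cube n" "g x \<le> g (z A)"
      by auto
    have upd: "z (insert i A) = (z A)(i := y i)"
      by (auto simp: z_def)
    have "z (insert i A) \<in> cube n"
      unfolding upd using fun_upd_in_cube[OF IH(1) i] cube_value[OF y i] by auto
    moreover have "g (z A) \<le> g (z (insert i A))"
    proof (cases "x i = y i")
      case True
      then have "z (insert i A) = z A"
        by (auto simp: z_def)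
      then show ?thesis by simp
    next
      case False
      with le[OF i] cube_value[OF x i] cube_value[OF y i] have xy: "x i = 0" "y i = 1"
        by auto
      have "z A i = 0"
        using insert.hyps xy(1) by (simp add: z_def)
      then have "z A = (z A)(i := 0)"
        by auto
      then have "g (z A) = g ((z A)(i := 0))"
        by (rule arg_cong)
      also have "\<dots> \<le> g (z (insert i A))"
        unfolding upd xy(2) using g IH(1) i by (auto simp: coordinatewise_increasing_def)
      finally show ?thesis .
    qed
    ultimately show ?case using IH(2) by auto
  qed
  from this[of "{1..n}"] have "z {1..n} \<in> cube n" "g x \<le> g (z {1..n})"
    by auto
  moreover from this(1) have "z {1..n} = y"
    by (rule cube_eqI) (use y in \<open>auto simp: z_def\<close>)
  ultimately show ?thesis by simp
qed

definition zeros :: "nat \<Rightarrow> nat \<Rightarrow> nat" where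
  "zeros n = (\<lambda>i\<in>{1..n}. 0)"

definition ones :: "nat \<Rightarrow> nat \<Rightarrow> nat" where
  "ones n = (\<lambda>i\<in>{1..n}. 1)"

lemma zeros_in_cube: "zeros n \<in> cube n"
  unfolding zeros_def cube_def by auto

lemma ones_in_cube: "ones n \<in> cube n"
  unfolding ones_def cube_def by auto

lemma cube_complement_ones: "cube_complement n (ones n) = zeros n"
  unfolding cube_complement_def ones_def zeros_def by auto

lemma increasing_between_extremes:
  assumes "coordinatewise_increasing n g" "x \<in> cube n"
  shows "g (zeros n) \<le> g x" "g x \<le> g (ones n)"
proof -
  show "g (zeros n) \<le> g x"
    by (rule coordinatewise_increasing_mono[OF assms(1) zeros_in_cube assms(2)])
       (simp add: zeros_def)
  show "g x \<le> g (ones n)"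
    by (rule coordinatewise_increasing_mono[OF assms(1) assms(2) ones_in_cube])
       (use cube_value[OF assms(2)] in \<open>force simp: ones_def\<close>)
qed

section \<open>The conjunction of all coordinates\<close>

lemma and_function_eq:
  assumes "x \<in> cube n"
  shows "and_function n x = (if x = ones n then 1 else 0)"
proof (cases "x = ones n")
  case False
  then obtain i where i: "i \<in> {1..n}" "x i \<noteq> ones n i"
    using cube_eqI[OF assms ones_in_cube] by blast
  then have "x i = 0"
    using cube_value[OF assms i(1)] by (auto simp: ones_def)
  with i(1) False show ?thesis
    by (auto simp: and_function_def intro!: prod_zero)
qed (simp add: and_function_def ones_def)

text \<open>Only the all-ones point contributes to an expectation against its indicator.\<close>

lemma Cov_and_function: "Cov n (and_function n) g = (g (ones n) - expect n g) / 2 ^ n"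
proof -
  have "(\<Sum>x\<in>cube n. and_function n x * h x) = h (ones n)" for h
  proof -
    have "(\<Sum>x\<in>cube n. and_function n x * h x) = (\<Sum>x\<in>cube n. if x = ones n then h x else 0)"
      by (intro sum.cong refl) (simp add: and_function_eq)
    then show ?thesis
      by (simp add: finite_cube ones_in_cube)
  qed
  from this[of g] this[of "\<lambda>_. 1"] show ?thesis
    by (simp add: Cov_def expect_eq_average diff_divide_distrib)
qed

lemma Cov_and_function_dual:
  "Cov n (and_function n) (dual n g) = (expect n g - g (zeros n)) / 2 ^ n"
proof -
  have "dual n g (ones n) = 1 - g (zeros n)"
    by (simp add: dual_def cube_complement_ones)
  then show ?thesis
    by (simp add: Cov_and_function expect_dual)
qed

lemma flip_coordinate:
  assumes "x \<in> cube n" "i \<in> {1..n}"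
  shows "add_mod2 n x (indicator {i}) = x(i := 1 - x i)"
proof
  fix j
  show "add_mod2 n x (indicator {i}) j = (x(i := 1 - x i)) j"
  proof (cases "j \<in> {1..n}")
    case True
    then show ?thesis
      using cube_value[OF assms(1) True] by (auto simp: add_mod2_def indicator_def)
  next
    case False
    then show ?thesis
      using assms by (auto simp: add_mod2_def cube_def PiE_iff extensional_def)
  qed
qed

text \<open>Coordinate \<open>i\<close> is pivotal for the conjunction exactly at the two points whose other
  coordinates are all \<open>1\<close>.\<close>

lemma influence_and_function:
  assumes i: "i \<in> {1..n}"
  shows "influence n i (and_function n) = 2 / 2 ^ n"
proof -
  let ?P = "{x. and_function n x \<noteq> and_function n (add_mod2 n x (indicator {i}))}"
  have "cube n \<inter> ?P = {ones n, (ones n)(i := 0)}"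
  proof (intro equalityI subsetI)
    fix x assume "x \<in> cube n \<inter> ?P"
    then have x: "x \<in> cube n" and P: "and_function n x \<noteq> and_function n (x(i := 1 - x i))"
      using i by (auto simp: flip_coordinate)
    have "x(i := 1 - x i) \<in> cube n"
      by (rule fun_upd_in_cube[OF x i]) (use cube_value[OF x i] in auto)
    with P x have "x = ones n \<or> x(i := 1 - x i) = ones n"
      by (auto simp: and_function_eq split: if_splits)
    then show "x \<in> {ones n, (ones n)(i := 0)}"
    proof
      assume flip: "x(i := 1 - x i) = ones n"
      from fun_cong[OF this, of i] i have "x i = 0"
        using cube_value[OF x i] by (auto simp: ones_def)
      then have "x = (x(i := 1 - x i))(i := 0)"
        by auto
      then show ?thesis
        unfolding flip by simp
    qed simp
  next
    fix x assume "x \<in> {ones n, (ones n)(i := 0)}"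
    moreover have "ones n i = 1"
      using i by (simp add: ones_def)
    moreover from this have "(ones n)(i := 0) \<noteq> ones n" "(ones n)(i := 1) = ones n"
      by (metis fun_upd_same zero_neq_one, auto)
    ultimately show "x \<in> cube n \<inter> ?P"
      using i ones_in_cube[of n] fun_upd_in_cube[OF ones_in_cube i, of 0]
      by (auto simp: flip_coordinate and_function_eq)
  qed
  moreover have "ones n \<noteq> (ones n)(i := 0)"
    using i by (metis fun_upd_same ones_def restrict_apply' zero_neq_one)
  ultimately have "card (cube n \<inter> ?P) = 2"
    by simp
  then show ?thesis
    unfolding influence_def uniform_cube_def
    by (simp add: measure_pmf_of_set finite_cube cube_not_empty card_cube)
qed

section \<open>The Fourier sum and the constant one quarter\<close>

text \<open>All coordinates being equally influential, the sum is a multiple of the variance of \<open>g\<close>, and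
  a Boolean function equals its square.\<close>

lemma fourier_sum_and_function:
  assumes g: "boolean_function n g"
  shows "(\<Sum>S\<in>{S. S \<noteq> {} \<and> S \<subseteq> {1..n}}.
      (fourier n g S)\<^sup>2 * Max ((\<lambda>i. influence n i (and_function n)) ` S)) =
    2 / 2 ^ n * (expect n g * (1 - expect n g))"
proof -
  have Max_eq: "Max ((\<lambda>i. influence n i (and_function n)) ` S) = 2 / 2 ^ n"
    if "S \<noteq> {}" "S \<subseteq> {1..n}" for S
  proof -
    from that have "(\<lambda>i. influence n i (and_function n)) ` S = {2 / 2 ^ n}"
      by (force simp: influence_and_function)
    then show ?thesis by simp
  qed
  have "expect n (\<lambda>x. (g x)\<^sup>2) = expect n g"
    unfolding expect_eq_average
    using g by (intro arg_cong2[where f = "(/)"] sum.cong refl)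
      (auto simp: boolean_function_def Pi_iff power2_eq_square)
  with parseval_variance[of n g]
  have "(\<Sum>S\<in>{S. S \<noteq> {} \<and> S \<subseteq> {1..n}}. (fourier n g S)\<^sup>2) = expect n g * (1 - expect n g)"
    by (simp add: power2_eq_square right_diff_distrib)
  moreover have "(\<Sum>S\<in>{S. S \<noteq> {} \<and> S \<subseteq> {1..n}}.
      (fourier n g S)\<^sup>2 * Max ((\<lambda>i. influence n i (and_function n)) ` S)) =
    (\<Sum>S\<in>{S. S \<noteq> {} \<and> S \<subseteq> {1..n}}. (fourier n g S)\<^sup>2 * (2 / 2 ^ n))"
    by (intro sum.cong refl) (use Max_eq in auto)
  ultimately show ?thesis
    by (simp only: sum_distrib_right[symmetric] mult.commute)
qed

lemma fourier_sum_eq_harmonic_mean: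
  assumes g: "boolean_function n g" and inc: "coordinatewise_increasing n g"
  defines "a \<equiv> Cov n (and_function n) g" and "b \<equiv> Cov n (and_function n) (dual n g)"
  shows "(\<Sum>S\<in>{S. S \<noteq> {} \<and> S \<subseteq> {1..n}}.
      (fourier n g S)\<^sup>2 * Max ((\<lambda>i. influence n i (and_function n)) ` S)) =
    (if a + b = 0 then 0 else 2 * a * b / (a + b))"
proof -
  define p where "p = expect n g"
  have a: "a = (g (ones n) - p) / 2 ^ n" and b: "b = (p - g (zeros n)) / 2 ^ n"
    unfolding a_def b_def p_def by (rule Cov_and_function, rule Cov_and_function_dual)
  have extremes: "g (zeros n) \<in> {0, 1}" "g (ones n) \<in> {0, 1}"
    using g zeros_in_cube ones_in_cube by (auto simp: boolean_function_def)
  have "2 / 2 ^ n * (p * (1 - p)) = (if a + b = 0 then 0 else 2 * a * b / (a + b))"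
  proof (cases "g (zeros n) = g (ones n)")
    case True
    have "g x = g (ones n)" if "x \<in> cube n" for x
      using increasing_between_extremes[OF inc that] True by simp
    then have "p = g (ones n)"
      by (simp add: p_def expect_eq_average card_cube)
    with extremes(2) show ?thesis
      by (auto simp: a b True)
  next
    case False
    with increasing_between_extremes(1)[OF inc ones_in_cube] extremes
    have "g (zeros n) = 0" "g (ones n) = 1"
      by auto
    then have "a = (1 - p) / 2 ^ n" "b = p / 2 ^ n"
      by (simp_all add: a b)
    moreover from this have "a + b = 1 / 2 ^ n"
      by (simp add: add_divide_distrib[symmetric])
    ultimately show ?thesis
      by simp
  qed
  with fourier_sum_and_function[OF g] show ?thesis
    by (simp add: p_def)
qed

text \<open>In dimension one the conjunction is the coordinate itself, which is antipodal, so it may be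
  taken as both functions. Antipodality forces its mean to be \<open>1/2\<close>.\<close>

lemma dictator_equality_case:
  "boolean_function 1 (and_function 1)" "coordinatewise_increasing 1 (and_function 1)"
  "antipodal 1 (and_function 1)"
  "Cov 1 (and_function 1) (and_function 1) = 1 / 4"
  "Min ((\<lambda>i. influence 1 i (and_function 1)) ` {1..1}) = 1"
proof -
  show "boolean_function 1 (and_function 1)"
    by (auto simp: boolean_function_def and_function_eq)
  show "coordinatewise_increasing 1 (and_function 1)"
    by (auto simp: coordinatewise_increasing_def and_function_def)
  show anti: "antipodal 1 (and_function 1)"
    using cube_value[of _ 1 1]
    by (force simp: antipodal_def dual_def and_function_def cube_complement_def)
  have "expect 1 (and_function 1) = 1 / 2"
    using expect_dual[of 1 "and_function 1"] anti
    by (simp add: antipodal_def expect_eq_average)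
  then show "Cov 1 (and_function 1) (and_function 1) = 1 / 4"
    using ones_in_cube by (simp add: Cov_and_function and_function_eq)
  show "Min ((\<lambda>i. influence 1 i (and_function 1)) ` {1..1}) = 1"
    using influence_and_function[of 1 1] by simp
qed

theorem proposition5p1:
  shows "(\<forall>n\<ge>1. \<forall>g. boolean_function n g \<and> coordinatewise_increasing n g \<longrightarrow>
      (\<Sum>S\<in>{S. S \<noteq> {} \<and> S \<subseteq> {1..n}}.
          (fourier n g S)\<^sup>2 * Max ((\<lambda>i. influence n i (and_function n)) ` S)) =
      (let a = Cov n (and_function n) g; b = Cov n (and_function n) (dual n g)
       in if a + b = 0 then 0 else 2 * a * b / (a + b)))
    \<and>
    \<not> (\<exists>c::real. c > 1 / 4 \<and>
      (\<forall>n\<ge>1. \<forall>f g.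
         boolean_function n f \<and> coordinatewise_increasing n f \<and>
         boolean_function n g \<and> coordinatewise_increasing n g \<and> antipodal n g \<longrightarrow>
         Cov n f g \<ge> c * Min ((\<lambda>i. influence n i f) ` {1..n})))"
proof (intro conjI notI)
  show "\<forall>n\<ge>1. \<forall>g. boolean_function n g \<and> coordinatewise_increasing n g \<longrightarrow>
      (\<Sum>S\<in>{S. S \<noteq> {} \<and> S \<subseteq> {1..n}}.
          (fourier n g S)\<^sup>2 * Max ((\<lambda>i. influence n i (and_function n)) ` S)) =
      (let a = Cov n (and_function n) g; b = Cov n (and_function n) (dual n g)
       in if a + b = 0 then 0 else 2 * a * b / (a + b))"
    unfolding Let_def by (intro allI impI fourier_sum_eq_harmonic_mean) auto
next
  assume "\<exists>c::real. c > 1 / 4 \<and>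
      (\<forall>n\<ge>1. \<forall>f g.
         boolean_function n f \<and> coordinatewise_increasing n f \<and>
         boolean_function n g \<and> coordinatewise_increasing n g \<and> antipodal n g \<longrightarrow>
         Cov n f g \<ge> c * Min ((\<lambda>i. influence n i f) ` {1..n}))"
  then obtain c :: real where c: "c > 1 / 4"
    and bound: "\<And>n f g. n \<ge> 1 \<Longrightarrow> boolean_function n f \<Longrightarrow> coordinatewise_increasing n f \<Longrightarrow>
      boolean_function n g \<Longrightarrow> coordinatewise_increasing n g \<Longrightarrow> antipodal n g \<Longrightarrow>
      Cov n f g \<ge> c * Min ((\<lambda>i. influence n i f) ` {1..n})"
    by blast
  from bound[OF order_refl dictator_equality_case(1,2,1,2,3)] c show False
    unfolding dictator_equality_case(4,5) by simp
qed

end
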